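(* Let $\alpha=p/q$, where $p,q$ are fixed positive integers with $p<q/2$, and let $0<c\le 1$ be a constant. Let Alice and Bob hold disjoint sets $A$ and $B$, respectively, of elements from $[n]=\{1,2,\ldots,n\}$, where $s=|A|\le |B|=m$. Let $t=s+m$ denote the total number of elements in $A\cup B$, where $t\ge cn$. Assume that $t$, $c$, and $\alpha$ are known to both players. Put $h=\left\lceil\frac{2q}{q-2p}\right\rceil$ and $\ell=\left\lceil\log\frac{12h}{c}\right\rceil$. Then an $(\alpha t,\alpha t)$-mediocre element of $A\cup B$ can be found (by at least one player) by a deterministic protocol with communication complexity $O(\ell\log h)=O(1)$. If both players return an element, each element returned is $(\alpha t,\alpha t)$-mediocre; the elements found by the two players need not be the same.
   Context: Two-party communication model (Yao): Alice knows only $A$ and Bob knows only $B$, together with the public parameters $n,t,c,\alpha$. They exchange bits according to a deterministic protocol: the messages sent so far determine who speaks next, and each message is a function of the speaker's own input and the messages so far. The communication complexity of a protocol is the maximum, over all admissible inputs, of the total number of bits exchanged; local computation is free. Output convention: at the end of the protocol, each player, as a function of his/her own input and the transcript, either returns an element (locally, without having to communicate it to the other player) or returns nothing. "Found by at least one player" means that on every admissible input at least one of the two players returns an element, and each element returned is an $(\alpha t,\alpha t)$-mediocre element of $A\cup B$. Mediocre element: an element of a finite totally ordered set $S$ is $(i,j)$-mediocre if it is neither among the top (i.e., largest) $i$ nor among the bottom (i.e., smallest) $j$ elements of $S$. Floors are omitted in the notation: $(\alpha t,\alpha t)$-mediocre means $(\lfloor\alpha t\rfloor,\lfloor\alpha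 t\rfloor)$-mediocre. Logarithms are in base $2$. The asymptotic notation is for $n\to\infty$ with $p,q,c$ fixed; in particular the $O(1)$ bound is a constant depending on $q$ and $c$ only, independent of $n$ and of the inputs. *)

theory Defs
  imports Complex_Main
begin

text \<open>
  Deterministic two-party protocols are given as protocol trees. A node is reached by exactly one
  sequence of bits, so the messages sent so far determine who speaks next, and the bit sent is a
  function of the speaker's own input alone at that node. At a leaf, each player computes an
  optional output from the player's own input.
\<close>

datatype ('a, 'b, 'r) protocol =
    Halt "'a \<Rightarrow> 'r option" "'b \<Rightarrow> 'r option"
  | Alice "'a \<Rightarrow> bool" "('a, 'b, 'r) protocol" "('a, 'b, 'r) protocol"
  | Bob "'b \<Rightarrow> bool" "('a, 'b, 'r) protocol" "('a, 'b, 'r) protocol"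

primrec transcript :: "('a, 'b, 'r) protocol \<Rightarrow> 'a \<Rightarrow> 'b \<Rightarrow> bool list" where
  "transcript (Halt f g) x y = []"
| "transcript (Alice a P Q) x y = a x # (if a x then transcript P x y else transcript Q x y)"
| "transcript (Bob b P Q) x y = b y # (if b y then transcript P x y else transcript Q x y)"

primrec outputs :: "('a, 'b, 'r) protocol \<Rightarrow> 'a \<Rightarrow> 'b \<Rightarrow> 'r option \<times> 'r option" where
  "outputs (Halt f g) x y = (f x, g y)"
| "outputs (Alice a P Q) x y = (if a x then outputs P x y else outputs Q x y)"
| "outputs (Bob b P Q) x y = (if b y then outputs P x y else outputs Q x y)"

text \<open>
  The transcript length is bounded by the height of the tree, so the supremum below is a maximum
  whenever the set of inputs is nonempty; on natural numbers the supremum of the empty set is 0.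
\<close>

definition comm_complexity :: "('a, 'b, 'r) protocol \<Rightarrow> ('a \<times> 'b) set \<Rightarrow> nat" where
  "comm_complexity P I = (SUP (x, y)\<in>I. length (transcript P x y))"

definition finds ::
    "('a, 'b, 'r) protocol \<Rightarrow> ('a \<times> 'b) set \<Rightarrow> ('a \<Rightarrow> 'b \<Rightarrow> 'r \<Rightarrow> bool) \<Rightarrow> bool" where
  "finds P I good \<longleftrightarrow>
     (\<forall>(x, y)\<in>I. case outputs P x y of (u, v) \<Rightarrow>
        (u \<noteq> None \<or> v \<noteq> None) \<and> (\<forall>r \<in> set_option u \<union> set_option v. good x y r))"

definition largest :: "nat \<Rightarrow> 'a::linorder set \<Rightarrow> 'a set" where
  "largest i S = {x \<in> S. card {y \<in> S. x < y} < i}"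

definition smallest :: "nat \<Rightarrow> 'a::linorder set \<Rightarrow> 'a set" where
  "smallest j S = {x \<in> S. card {y \<in> S. y < x} < j}"

definition mediocre :: "nat \<Rightarrow> nat \<Rightarrow> 'a::linorder set \<Rightarrow> 'a \<Rightarrow> bool" where
  "mediocre i j S x \<longleftrightarrow> x \<in> S \<and> x \<notin> largest i S \<and> x \<notin> smallest j S"

definition admissible :: "nat \<Rightarrow> nat \<Rightarrow> (nat set \<times> nat set) set" where
  "admissible n t = {(A, B). A \<subseteq> {1..n} \<and> B \<subseteq> {1..n} \<and> A \<inter> B = {} \<and>
     card A \<le> card B \<and> t = card A + card B}"

end

theory Submission imports Defs begin

text \<open>
  Cut the universe into \<open>2 ^ l\<close> blocks of width \<open>w\<close>. A binary search over the block boundaries, in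
  which Alice sends her count below the current boundary rounded down to a multiple of
  \<open>d \<approx> t / h\<close> and Bob answers with the direction, yields a boundary whose rank exceeds
  \<open>k = \<lfloor>\<alpha> t\<rfloor>\<close> by at most about \<open>d + w\<close>. Just above it the players compare the blocks of their
  next elements: the player with the smaller block, or Alice if both blocks agree, returns her or
  his element, which overshoots the next element of the union by less than \<open>w\<close> ranks. As
  \<open>t - 2 k \<ge> 2 t / h\<close>, all these errors fit into the window of mediocre ranks.
\<close>

section \<open>Sending a number bit by bit, lowest bit first\<close>

text \<open>Only \<open>f x\<close> modulo \<open>2 ^ i\<close> arrives.\<close>

primrec alice_sends ::
    "nat \<Rightarrow> ('a \<Rightarrow> nat) \<Rightarrow> (nat \<Rightarrow> ('a, 'b, 'r) protocol) \<Rightarrow> ('a, 'b, 'r) protocol" where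
  "alice_sends 0 f Q = Q 0"
| "alice_sends (Suc i) f Q =
     Alice (\<lambda>x. odd (f x))
       (alice_sends i (\<lambda>x. f x div 2) (\<lambda>v. Q (2 * v + 1)))
       (alice_sends i (\<lambda>x. f x div 2) (\<lambda>v. Q (2 * v)))"

lemma outputs_alice_sends:
  "f x < 2 ^ i \<Longrightarrow> outputs (alice_sends i f Q) x y = outputs (Q (f x)) x y"
proof (induction i arbitrary: f Q)
  case (Suc i)
  then have "f x div 2 < 2 ^ i" by simp
  then show ?case
    using Suc.IH[of "\<lambda>x. f x div 2"] by (simp add: odd_two_times_div_two_succ)
qed simp

lemma length_transcript_alice_sends:
  "f x < 2 ^ i \<Longrightarrow>
    length (transcript (alice_sends i f Q) x y) = i + length (transcript (Q (f x)) x y)"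
proof (induction i arbitrary: f Q)
  case (Suc i)
  then have "f x div 2 < 2 ^ i" by simp
  then show ?case
    using Suc.IH[of "\<lambda>x. f x div 2"] by (simp add: odd_two_times_div_two_succ)
qed simp

text \<open>Correctness is a condition on each input separately, so it can be proved for one fixed
  pair.\<close>

lemma finds_iff:
  "finds P I good \<longleftrightarrow> (\<forall>(x, y)\<in>I. finds P {(x, y)} good)"
  unfolding finds_def by auto

lemma comm_complexity_le:
  assumes "\<And>x y. (x, y) \<in> I \<Longrightarrow> length (transcript P x y) \<le> b"
  shows "comm_complexity P I \<le> b"
\<comment> \<open>The empty case does occur: \<open>admissible n t\<close> is empty when
  \<open>t > n\<close>.\<close>
proof (cases "I = {}")
  case False
  then show ?thesis
    unfolding comm_complexity_def using assms by (intro cSUP_least) auto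
qed (simp add: comm_complexity_def)

section \<open>Ranks, blocks and counts\<close>

text \<open>Below \<open>r\<close> lie the elements up to \<open>u\<close>, at least
  \<open>k\<close> of them, and at most \<open>w - 1\<close> more. With \<open>r\<close> itself
  removed, the last assumption leaves at least \<open>k\<close> elements above.\<close>

lemma mediocre_above_threshold:
  fixes S :: "'a::linorder set"
  assumes "finite S" "r \<in> S" "u < r"
    and "k \<le> card {y \<in> S. y \<le> u}"
    and "card {y \<in> S. u < y \<and> y < r} < w"
    and "card {y \<in> S. y \<le> u} + w + k \<le> card S"
  shows "mediocre k k S r"
proof -
  have "{y \<in> S. y < r} = {y \<in> S. y \<le> u} \<union> {y \<in> S. u < y \<and> y < r}"
    using \<open>u < r\<close> by auto
  then have below:
    "card {y \<in> S. y < r} = card {y \<in> S. y \<le> u} + card {y \<in> S. u < y \<and> y < r}"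
    using \<open>finite S\<close> by (simp add: card_Un_disjoint disjoint_iff not_less)
  have "S = insert r ({y \<in> S. y < r} \<union> {y \<in> S. r < y})"
    using \<open>r \<in> S\<close> by auto
  also have "card \<dots> = Suc (card ({y \<in> S. y < r} \<union> {y \<in> S. r < y}))"
    using \<open>finite S\<close> by (subst card_insert_disjoint) auto
  also have "\<dots> = Suc (card {y \<in> S. y < r} + card {y \<in> S. r < y})"
    using \<open>finite S\<close> by (subst card_Un_disjoint) auto
  finally have "card S = Suc (card {y \<in> S. y < r} + card {y \<in> S. r < y})" .
  with below assms show ?thesis
    by (auto simp: mediocre_def largest_def smallest_def)
qed

text \<open>The elements counted share the block of \<open>r\<close> and precede \<open>r\<close>,
  so there are at most \<open>r mod w\<close> of them.\<close>

lemma card_between_same_block: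
  fixes S :: "nat set"
  assumes "0 < w" and "\<And>y. y \<in> S \<Longrightarrow> u < y \<Longrightarrow> y < r \<Longrightarrow> r div w \<le> y div w"
  shows "card {y \<in> S. u < y \<and> y < r} < w"
proof -
  have "{y \<in> S. u < y \<and> y < r} \<subseteq> {r div w * w..<r}"
  proof
    fix y assume "y \<in> {y \<in> S. u < y \<and> y < r}"
    then have "r div w * w \<le> y div w * w" "y < r"
      using assms(2) by (simp_all add: mult_le_mono1)
    moreover have "y div w * w \<le> y" by simp
    ultimately show "y \<in> {r div w * w..<r}" by (metis atLeastLessThan_iff le_trans)
  qed
  then have "card {y \<in> S. u < y \<and> y < r} \<le> card {r div w * w..<r}"
    by (rule card_mono[rotated]) simp
  also have "\<dots> < w"
    using \<open>0 < w\<close> by (simp add: minus_div_mult_eq_mod)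
  finally show ?thesis .
qed

definition count_upto :: "nat set \<Rightarrow> nat \<Rightarrow> nat" where
  "count_upto S u = card {y \<in> S. y \<le> u}"

lemma count_upto_Un:
  assumes "finite A" "finite B" "A \<inter> B = {}"
  shows "count_upto (A \<union> B) u = count_upto A u + count_upto B u"
proof -
  have "{y \<in> A \<union> B. y \<le> u} = {y \<in> A. y \<le> u} \<union> {y \<in> B. y \<le> u}" by auto
  then show ?thesis
    using assms by (simp add: count_upto_def card_Un_disjoint disjoint_iff)
qed

lemma count_upto_add_le: "count_upto S (u + w) \<le> count_upto S u + w"
proof -
  have "{y \<in> S. y \<le> u + w} \<subseteq> {y \<in> S. y \<le> u} \<union> {u<..u + w}" by auto
  then have "card {y \<in> S. y \<le> u + w} \<le> card ({y \<in> S. y \<le> u} \<union> {u<..u + w})"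
    by (rule card_mono[rotated]) simp
  also have "\<dots> \<le> card {y \<in> S. y \<le> u} + card {u<..u + w}" by (rule card_Un_le)
  finally show ?thesis by (simp add: count_upto_def)
qed

section \<open>The protocol\<close>

text \<open>Here \<open>d\<close> is the rounding step, \<open>w\<close> the block width, and
  \<open>b\<close> the number of bits for a rounded count. The slack \<open>2\<close> in
  \<open>window\<close> is earned by two strict inequalities in the search.\<close>

locale block_search =
  fixes n t k d w l b :: nat
  assumes k_pos: "0 < k" and d_pos: "0 < d" and w_pos: "0 < w"
    and blocks: "n < 2 ^ l * w" and counts: "t < 2 ^ b * d"
    and window: "2 * k + d + 2 * w \<le> t + 2"
begin

text \<open>The default \<open>n + w\<close> lies in a later block than every element of \<open>{1..n}\<close>.\<close>

definition next_above :: "nat \<Rightarrow> nat set \<Rightarrow> nat" where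
  "next_above u S = Min (insert (n + w) {y \<in> S. u < y})"

text \<open>\<open>Suc l\<close> bits are sent because the block of the default may have index
  \<open>2 ^ l\<close>. Bob's bit tells Alice which of the two returns an element.\<close>

definition compare_next :: "nat \<Rightarrow> (nat set, nat set, nat) protocol" where
  "compare_next u =
     alice_sends (Suc l) (\<lambda>A. next_above u A div w)
       (\<lambda>v. Bob (\<lambda>B. next_above u B div w < v)
         (Halt (\<lambda>A. None) (\<lambda>B. Some (next_above u B)))
         (Halt (\<lambda>A. Some (next_above u A)) (\<lambda>B. None)))"

text \<open>State \<open>(i, j)\<close>: the estimated rank passes \<open>k\<close> between
  boundaries \<open>j\<close> and \<open>j + 2 ^ i\<close>. At the end the upper boundary is used,
  where the rank is at least \<open>k\<close>.\<close>

primrec search :: "nat \<Rightarrow> nat \<Rightarrow> (nat set, nat set, nat) protocol" where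
  "search 0 j = compare_next (Suc j * w)"
| "search (Suc i) j =
     alice_sends b (\<lambda>A. count_upto A ((j + 2 ^ i) * w) div d)
       (\<lambda>v. Bob (\<lambda>B. v * d + count_upto B ((j + 2 ^ i) * w) < k)
         (search i (j + 2 ^ i)) (search i j))"

section \<open>Correctness and cost on a fixed input\<close>

context
  fixes A B :: "nat set"
  assumes adm: "(A, B) \<in> admissible n t"
begin

lemma
  shows A_sub: "A \<subseteq> {1..n}" and B_sub: "B \<subseteq> {1..n}" and disj: "A \<inter> B = {}"
    and card_AB: "t = card A + card B" and card_le: "card A \<le> card B"
  using adm by (auto simp: admissible_def)

lemma finite_AB: "finite A" "finite B"
  using A_sub B_sub finite_subset by blast+

lemma card_Un: "card (A \<union> B) = t"
  using finite_AB disj card_AB by (simp add: card_Un_disjoint)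

lemma next_above_cases:
  assumes "S \<subseteq> {1..n}"
  shows "next_above u S \<in> S \<and> u < next_above u S \<or>
    next_above u S = n + w \<and> (\<forall>y\<in>S. y \<le> u)"
proof -
  have fin: "finite {y \<in> S. u < y}" using assms finite_subset by fastforce
  then have "next_above u S \<in> insert (n + w) {y \<in> S. u < y}"
    unfolding next_above_def by (intro Min_in) auto
  moreover have "n + w \<noteq> next_above u S" if "y \<in> S" "u < y" for y
  proof -
    have "next_above u S \<le> y"
      unfolding next_above_def using fin that by (intro Min_le) auto
    moreover have "y \<le> n" using assms that(1) by auto
    ultimately show ?thesis using w_pos by linarith
  qed
  ultimately show ?thesis by (metis insert_iff mem_Collect_eq not_le)
qed

lemma next_above_le:
  assumes "S \<subseteq> {1..n}" "y \<in> S" "u < y"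
  shows "next_above u S \<le> y"
proof -
  have "finite {y \<in> S. u < y}" using assms(1) finite_subset by fastforce
  then show ?thesis
    unfolding next_above_def using assms by (intro Min_le) auto
qed

lemma next_above_block_less:
  assumes "S \<subseteq> {1..n}"
  shows "next_above u S div w < 2 ^ Suc l"
proof -
  have "next_above u S \<le> n + w"
    using next_above_cases[OF assms, of u] assms by fastforce
  then have "next_above u S div w \<le> (n + w) div w" by (rule div_le_mono)
  also have "\<dots> = Suc (n div w)" using w_pos by simp
  finally have "next_above u S div w \<le> Suc (n div w)" .
  moreover have "n div w < 2 ^ l" using blocks w_pos by (simp add: div_less_iff_less_mult)
  moreover have "(1::nat) \<le> 2 ^ l" by simp
  ultimately show ?thesis unfolding power_Suc by linarith
qed

text \<open>The returned element lies in the earliest block that meets the union above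
  \<open>u\<close>, so fewer than \<open>w\<close> elements are skipped. The default is never
  returned, since some element above \<open>u\<close> exists and its block is earlier.\<close>

lemma finds_compare_next:
  assumes "k \<le> count_upto (A \<union> B) u" and "count_upto (A \<union> B) u + w + k \<le> t"
  shows "finds (compare_next u) {(A, B)} (\<lambda>A B. mediocre k k (A \<union> B))"
proof -
  let ?a = "next_above u A" and ?b = "next_above u B"
  have ex: "\<exists>y\<in>A \<union> B. u < y"
  proof (rule ccontr)
    assume "\<not> ?thesis"
    then have "{y \<in> A \<union> B. y \<le> u} = A \<union> B" by (auto simp: not_less)
    then have "count_upto (A \<union> B) u = t" by (simp only: count_upto_def card_Un)
    with assms(2) w_pos show False by simp
  qed
  have default: "y div w < (n + w) div w" if "y \<in> A \<union> B" for y
  proof -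
    have "y \<le> n" using that A_sub B_sub by auto
    then have "y div w \<le> n div w" by (rule div_le_mono)
    then show ?thesis using w_pos by simp
  qed
  have med: "mediocre k k (A \<union> B) r"
    if "r \<in> A \<union> B" "u < r"
      and "\<And>y. y \<in> A \<union> B \<Longrightarrow> u < y \<Longrightarrow> y < r \<Longrightarrow> r div w \<le> y div w" for r
  proof (rule mediocre_above_threshold)
    show "card {y \<in> A \<union> B. u < y \<and> y < r} < w"
      using w_pos that(3) by (rule card_between_same_block)
  qed (use finite_AB that assms card_Un in \<open>auto simp: count_upto_def\<close>)
  have out: "outputs (compare_next u) A B =
    (if ?b div w < ?a div w then (None, Some ?b) else (Some ?a, None))"
    unfolding compare_next_def
    by (subst outputs_alice_sends) (simp_all only: next_above_block_less[OF A_sub] outputs.simps)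
  show ?thesis
  proof (cases "?b div w < ?a div w")
    case True
    have "?a div w \<le> (n + w) div w"
      using next_above_cases[OF A_sub, of u] default[of ?a] by auto
    with True have "?b \<noteq> n + w" by auto
    then have b: "?b \<in> B" "u < ?b" using next_above_cases[OF B_sub, of u] by auto
    have "?b div w \<le> y div w" if "y \<in> A \<union> B" "u < y" for y
      using that True next_above_le[OF A_sub, of y u] next_above_le[OF B_sub, of y u]
        div_le_mono[of ?a y w] div_le_mono[of ?b y w] by auto
    then have "mediocre k k (A \<union> B) ?b" using b by (intro med) auto
    then show ?thesis using True out by (simp add: finds_def)
  next
    case False
    \<comment> \<open>If Alice had only the default, Bob would hold an element above
      \<open>u\<close> in an earlier block and would have won the comparison.\<close>
    have "?a \<in> A \<and> u < ?a"
    proof (rule ccontr)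
      assume "\<not> ?thesis"
      with next_above_cases[OF A_sub, of u] have a: "?a = n + w" "\<forall>y\<in>A. y \<le> u" by auto
      with ex next_above_cases[OF B_sub, of u] have "?b \<in> B" by fastforce
      then have "?b div w < (n + w) div w" using default by blast
      with False a show False by simp
    qed
    moreover have "?a div w \<le> y div w" if "y \<in> A \<union> B" "u < y" for y
      using that False next_above_le[OF A_sub, of y u] next_above_le[OF B_sub, of y u]
        div_le_mono[of ?a y w] div_le_mono[of ?b y w] by auto
    ultimately have "mediocre k k (A \<union> B) ?a" by (intro med) auto
    then show ?thesis using False out by (simp add: finds_def)
  qed
qed

text \<open>This is what Bob compares with \<open>k\<close>: only Alice's share is rounded, so the
  error stays below \<open>d\<close>.\<close>

definition estimate :: "nat \<Rightarrow> nat" where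
  "estimate j = count_upto A (j * w) div d * d + count_upto B (j * w)"

lemma estimate_bounds:
  "estimate j \<le> count_upto (A \<union> B) (j * w)"
  "count_upto (A \<union> B) (j * w) < estimate j + d"
proof -
  have "count_upto A (j * w) =
      count_upto A (j * w) div d * d + count_upto A (j * w) mod d" by simp
  moreover have "count_upto A (j * w) mod d < d" using d_pos by simp
  ultimately show "estimate j \<le> count_upto (A \<union> B) (j * w)"
    "count_upto (A \<union> B) (j * w) < estimate j + d"
    unfolding estimate_def count_upto_Un[OF finite_AB disj] by linarith+
qed

lemma message_less: "count_upto A u div d < 2 ^ b"
proof -
  have "count_upto A u \<le> card A"
    unfolding count_upto_def using finite_AB by (intro card_mono) auto
  with card_AB counts have "count_upto A u < 2 ^ b * d" by linarith
  then show ?thesis using d_pos by (simp add: div_less_iff_less_mult)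
qed

lemma outputs_search_Suc:
  "outputs (search (Suc i) j) A B =
    (if estimate (j + 2 ^ i) < k then outputs (search i (j + 2 ^ i)) A B
     else outputs (search i j) A B)"
  by (simp add: outputs_alice_sends message_less estimate_def)

text \<open>Invariant of the binary search: testing the midpoint keeps the passage of
  \<open>k\<close> inside one of the two halves.\<close>

lemma finds_search:
  assumes "estimate j < k" "k \<le> estimate (j + 2 ^ i)"
  shows "finds (search i j) {(A, B)} (\<lambda>A B. mediocre k k (A \<union> B))"
  using assms
proof (induction i arbitrary: j)
  case 0
  have "count_upto (A \<union> B) (Suc j * w) \<le> count_upto (A \<union> B) (j * w) + w"
    using count_upto_add_le[of "A \<union> B" "j * w" w] by (simp add: add.commute)
  \<comment> \<open>The estimate is at most \<open>k - 1\<close> and the rounding error at most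
    \<open>d - 1\<close>; this accounts for the \<open>2\<close> in \<open>window\<close>.\<close>
  moreover have "count_upto (A \<union> B) (j * w) < k - 1 + d"
    using estimate_bounds(2)[of j] 0(1) by linarith
  moreover have "k \<le> count_upto (A \<union> B) (Suc j * w)"
    using estimate_bounds(1)[of "Suc j"] 0(2) by simp
  ultimately show ?case
    unfolding search.simps using window k_pos by (intro finds_compare_next) linarith+
next
  case (Suc i)
  show ?case
  proof (cases "estimate (j + 2 ^ i) < k")
    case True
    moreover from Suc.prems have "k \<le> estimate (j + 2 ^ i + 2 ^ i)"
      by (simp add: mult_2 add.assoc)
    ultimately show ?thesis
      using Suc.IH[of "j + 2 ^ i"] outputs_search_Suc[of i j] by (simp add: finds_def)
  next
    case False
    then show ?thesis
      using Suc.IH[of j] Suc.prems outputs_search_Suc[of i j] by (simp add: finds_def)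
  qed
qed

text \<open>The invariant holds initially: boundary \<open>0\<close> has rank 0, and the last
  boundary has rank \<open>t\<close>, which \<open>window\<close> keeps far enough above
  \<open>k\<close> to absorb the rounding.\<close>

lemma finds_search_all: "finds (search l 0) {(A, B)} (\<lambda>A B. mediocre k k (A \<union> B))"
proof (rule finds_search)
  have "{y \<in> A \<union> B. y \<le> 0} = {}" using A_sub B_sub by auto
  then have "count_upto (A \<union> B) (0 * w) = 0" by (simp only: count_upto_def mult_0 card.empty)
  then show "estimate 0 < k" using estimate_bounds(1)[of 0] k_pos by simp
  have "{y \<in> A \<union> B. y \<le> 2 ^ l * w} = A \<union> B" using A_sub B_sub blocks by fastforce
  then have "count_upto (A \<union> B) (2 ^ l * w) = t" by (simp only: count_upto_def card_Un)
  then have "t < estimate (2 ^ l) + d" using estimate_bounds(2)[of "2 ^ l"] by simp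
  then show "k \<le> estimate (0 + 2 ^ l)" using window w_pos by simp
qed

text \<open>Each round costs \<open>b\<close> bits from Alice and one from Bob; the final comparison
  costs \<open>l + 1\<close> bits and one.\<close>

lemma length_search: "length (transcript (search i j) A B) = i * (b + 1) + l + 2"
proof (induction i arbitrary: j)
  case 0
  show ?case
    using next_above_block_less[OF A_sub]
    by (simp add: compare_next_def length_transcript_alice_sends del: power_Suc alice_sends.simps)
next
  case (Suc i)
  then show ?case by (simp add: length_transcript_alice_sends message_less)
qed

end

lemma finds_admissible: "finds (search l 0) (admissible n t) (\<lambda>A B. mediocre k k (A \<union> B))"
  by (subst finds_iff) (auto intro: finds_search_all)

lemma comm_complexity_search:
  "comm_complexity (search l 0) (admissible n t) \<le> l * (b + 1) + l + 2"
  by (rule comm_complexity_le) (simp add: length_search)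

end

section \<open>Choice of parameters\<close>

text \<open>For \<open>k = 0\<close> every element is mediocre, and Bob has one since he holds the larger set.\<close>

lemma finds_zero:
  assumes "0 < t"
  shows "finds (Halt (\<lambda>A. None) (\<lambda>B. Some (Min B)) :: (nat set, nat set, nat) protocol)
    (admissible n t) (\<lambda>A B. mediocre 0 0 (A \<union> B))"
proof -
  have "Min B \<in> B" if "(A, B) \<in> admissible n t" for A B
  proof (rule Min_in)
    show "finite B" using that finite_subset by (fastforce simp: admissible_def)
    show "B \<noteq> {}" using that assms by (auto simp: admissible_def)
  qed
  then show ?thesis
    by (auto simp: finds_def mediocre_def largest_def smallest_def)
qed

text \<open>With \<open>r = t / h\<close>, the two quotients are at most \<open>r\<close> and
  \<open>r / 12\<close>, while \<open>t - 2 * k\<close> is at least \<open>2 * r\<close>. After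
  cancelling the additive constants, an excess of 1 remains to be absorbed.\<close>

lemma rounding_errors_fit:
  fixes h n t k l :: nat and c :: real
  assumes "0 < h" "0 < c" "0 < t" "c * real n \<le> real t" "12 * real h / c \<le> 2 ^ l"
    and "2 * real t / real h \<le> real t - 2 * real k"
  shows "2 * k + (t div h + 1) + 2 * (n div 2 ^ l + 1) \<le> t + 2"
proof -
  define r d w where "r = real t / real h" and "d = real (t div h)" and "w = real (n div 2 ^ l)"
  have "w \<le> real n / 2 ^ l"
    unfolding w_def using of_nat_div_le_of_nat[of n "2 ^ l"] by simp
  also have "\<dots> \<le> real n / (12 * real h / c)"
    using assms by (intro divide_left_mono) auto
  also have "\<dots> = c * real n / (12 * real h)" by simp
  also have "\<dots> \<le> real t / (12 * real h)"
    using assms by (intro divide_right_mono) auto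
  finally have w: "12 * w \<le> r" by (simp add: r_def field_simps)
  have d: "d \<le> r" unfolding r_def d_def by (rule of_nat_div_le_of_nat)
  have r: "2 * r \<le> real t - 2 * real k" unfolding r_def using assms(6) by simp
  have r0: "0 < r" unfolding r_def using assms by simp
  \<comment> \<open>The excess 1 is absorbed by integrality of \<open>t - 2 * k > 0\<close>, by
    \<open>1 \<le> d \<le> r\<close>, or by \<open>r \<ge> 12\<close>, respectively.\<close>
  consider "d = 0" "w = 0" | "1 \<le> d" "w = 0" | "1 \<le> w"
    unfolding d_def w_def by (cases "t div h"; cases "n div 2 ^ l") auto
  then show ?thesis
  proof cases
    case 1
    from r r0 have "2 * k < t" by linarith
    with 1 show ?thesis by (simp add: d_def w_def)
  next
    case 2
    with d r have "2 * real k + (d + 1) + 2 * (w + 1) \<le> real t + 2" by simp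
    then have "real (2 * k + (t div h + 1) + 2 * (n div 2 ^ l + 1)) \<le> real (t + 2)"
      by (simp add: d_def w_def)
    then show ?thesis by (simp only: of_nat_le_iff)
  next
    case 3
    with d w have "d + 1 + 2 * w \<le> 2 * r" by linarith
    with r have "2 * real k + (d + 1) + 2 * (w + 1) \<le> real t + 2" by simp
    then have "real (2 * k + (t div h + 1) + 2 * (n div 2 ^ l + 1)) \<le> real (t + 2)"
      by (simp add: d_def w_def)
    then show ?thesis by (simp only: of_nat_le_iff)
  qed
qed

lemma exists_protocol:
  fixes h n t k l :: nat and c :: real
  assumes "2 \<le> h" "0 < l" "0 < c" "0 < t" "c * real n \<le> real t" "12 * real h / c \<le> 2 ^ l"
    and "2 * real t / real h \<le> real t - 2 * real k"
  shows "\<exists>P :: (nat set, nat set, nat) protocol.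
    finds P (admissible n t) (\<lambda>A B. mediocre k k (A \<union> B)) \<and>
    real (comm_complexity P (admissible n t)) \<le> 6 * (real l * log 2 (real h))"
proof -
  have log: "1 \<le> log 2 (real h)" using assms(1) by simp
  show ?thesis
  proof (cases "k = 0")
    case True
    have "comm_complexity (Halt (\<lambda>A. None) (\<lambda>B. Some (Min B))
        :: (nat set, nat set, nat) protocol) (admissible n t) \<le> 0"
      by (rule comm_complexity_le) simp
    moreover have "0 \<le> 6 * (real l * log 2 (real h))" using log by simp
    ultimately show ?thesis
      using True finds_zero[OF assms(4), of n] by (metis le_zero_eq of_nat_0)
  next
    case False
    \<comment> \<open>Since \<open>t < h * (t div h + 1)\<close>, a rounded count takes at most
      \<open>h\<close> values, so about \<open>log h\<close> bits suffice.\<close>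
    define b where "b = nat \<lceil>log 2 (real h)\<rceil>"
    have b: "log 2 (real h) \<le> real b" "real b \<le> log 2 (real h) + 1"
      unfolding b_def using log by linarith+
    then have "real h \<le> 2 powr real b" using assms(1) by (simp add: log_le_iff)
    then have "real h \<le> real (2 ^ b)" by (simp add: powr_realpow)
    then have hb: "h \<le> 2 ^ b" by linarith
    have "t < h * (t div h + 1)"
      using assms(1) dividend_less_times_div[of h t] by simp
    also have "\<dots> \<le> 2 ^ b * (t div h + 1)" using hb by (rule mult_le_mono1)
    finally have "t < 2 ^ b * (t div h + 1)" .
    moreover have "n < 2 ^ l * (n div 2 ^ l + 1)"
      using dividend_less_times_div[of "2 ^ l" n] by simp
    ultimately interpret block_search n t k "t div h + 1" "n div 2 ^ l + 1" l b
      using False rounding_errors_fit[of h c t n l k] assms by unfold_locales auto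
    have "real (comm_complexity (search l 0) (admissible n t)) \<le> real (l * (b + 1) + l + 2)"
      using comm_complexity_search by (simp only: of_nat_le_iff)
    also have "\<dots> = real l * (real b + 2) + 2" by (simp add: algebra_simps)
    \<comment> \<open>The constant 6 arises from \<open>b + 4 \<le> log h + 5\<close> together with
      \<open>log h \<ge> 1\<close>.\<close>
    also have "\<dots> \<le> real l * (real b + 2) + real l * 2" using assms(2) by simp
    also have "\<dots> = real l * (real b + 4)" by (simp add: algebra_simps)
    also have "\<dots> \<le> real l * (6 * log 2 (real h))"
      using b log by (intro mult_left_mono) linarith+
    also have "\<dots> = 6 * (real l * log 2 (real h))" by simp
    finally show ?thesis using finds_admissible by blast
  qed
qed

section \<open>The bound in terms of \<open>q\<close> and \<open>c\<close>\<close>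

theorem theorem3:
  "\<exists>(K::real) > 0. \<exists>C :: nat \<Rightarrow> real \<Rightarrow> real. \<forall>(p::nat) (q::nat) (c::real).
     0 < p \<and> 0 < q \<and> real p < real q / 2 \<and> 0 < c \<and> c \<le> 1 \<longrightarrow>
     (let \<alpha> = real p / real q;
          h = \<lceil>2 * real q / (real q - 2 * real p)\<rceil>;
          l = \<lceil>log 2 (12 * real_of_int h / c)\<rceil>;
          bound = K * (real_of_int l * log 2 (real_of_int h))
      in bound \<le> C q c \<and>
         (\<forall>(n::nat) (t::nat). 1 \<le> n \<and> c * real n \<le> real t \<longrightarrow>
            (\<exists>P :: (nat set, nat set, nat) protocol.
               finds P (admissible n t)
                 (\<lambda>A B. mediocre (nat \<lfloor>\<alpha> * real t\<rfloor>) (nat \<lfloor>\<alpha> * real t\<rfloor>) (A \<union> B)) \<and>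
               real (comm_complexity P (admissible n t)) \<le> bound)))"
proof -
  \<comment> \<open>Obtained from \<open>h \<le> 2 * q\<close> and from bounding the ceiling in
    \<open>l\<close> by one more than its argument.\<close>
  define C :: "nat \<Rightarrow> real \<Rightarrow> real" where
    "C = (\<lambda>q c. 6 * ((log 2 (24 * real q / c) + 1) * log 2 (2 * real q)))"
  have main: "let \<alpha> = real p / real q;
          h = \<lceil>2 * real q / (real q - 2 * real p)\<rceil>;
          l = \<lceil>log 2 (12 * real_of_int h / c)\<rceil>;
          bound = 6 * (real_of_int l * log 2 (real_of_int h))
      in bound \<le> C q c \<and>
         (\<forall>(n::nat) (t::nat). 1 \<le> n \<and> c * real n \<le> real t \<longrightarrow>
            (\<exists>P :: (nat set, nat set, nat) protocol.
               finds P (admissible n t)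
                 (\<lambda>A B. mediocre (nat \<lfloor>\<alpha> * real t\<rfloor>) (nat \<lfloor>\<alpha> * real t\<rfloor>) (A \<union> B)) \<and>
               real (comm_complexity P (admissible n t)) \<le> bound))"
    if asm: "0 < p" "real p < real q / 2" "0 < c" "c \<le> 1" for p q :: nat and c :: real
  proof -
    define h where "h = nat \<lceil>2 * real q / (real q - 2 * real p)\<rceil>"
    define l where "l = nat \<lceil>log 2 (12 * real h / c)\<rceil>"
    have "2 * p < q" using asm(2) by linarith
    \<comment> \<open>Integrality makes the gap at least 1, which bounds \<open>h\<close>
      independently of \<open>p\<close>.\<close>
    then have gap: "1 \<le> real q - 2 * real p" by linarith
    have ratio_gt: "2 < 2 * real q / (real q - 2 * real p)"
      using gap asm(1) by (simp add: field_simps)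
    have ratio_le: "2 * real q / (real q - 2 * real p) \<le> 2 * real q"
      using gap by (simp add: divide_le_eq mult_le_cancel_left1)
    have h_eq: "\<lceil>2 * real q / (real q - 2 * real p)\<rceil> = int h"
      unfolding h_def using ratio_gt by linarith
    have h_ge: "2 * real q / (real q - 2 * real p) \<le> real h"
      unfolding h_def by linarith
    have h2: "2 \<le> h" using h_ge ratio_gt by linarith
    have "\<lceil>2 * real q / (real q - 2 * real p)\<rceil> \<le> int (2 * q)"
      using ratio_le by (simp add: ceiling_le_iff)
    then have h_le: "h \<le> 2 * q" unfolding h_def by linarith
    have "1 \<le> 12 * real h / c" using h2 asm by (simp add: field_simps)
    then have "2 \<le> 12 * real h / c" using h2 asm by (simp add: field_simps)
    then have log_ge: "1 \<le> log 2 (12 * real h / c)" by simp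
    have l_eq: "\<lceil>log 2 (12 * real h / c)\<rceil> = int l"
      unfolding l_def using log_ge by linarith
    have l_bounds: "log 2 (12 * real h / c) \<le> real l" "real l \<le> log 2 (12 * real h / c) + 1"
      unfolding l_def using log_ge by linarith+
    have l_pos: "0 < l" using l_bounds log_ge by linarith
    have "12 * real h / c \<le> 2 powr real l"
      using l_bounds(1) h2 asm(3) by (subst (asm) log_le_iff) auto
    then have two_l: "12 * real h / c \<le> 2 ^ l" by (simp add: powr_realpow)
    have bound: "6 * (real l * log 2 (real h)) \<le> C q c"
    proof -
      have "log 2 (real h) \<le> log 2 (2 * real q)"
        using h2 h_le by simp
      moreover have "12 * real h / c \<le> 24 * real q / c"
        using h_le asm(3) by (intro divide_right_mono) auto
      then have "log 2 (12 * real h / c) \<le> log 2 (24 * real q / c)"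
        using h2 asm(3) by (intro log_mono) auto
      then have "real l \<le> log 2 (24 * real q / c) + 1" using l_bounds by linarith
      moreover have "0 \<le> log 2 (real h)" using h2 by simp
      ultimately show ?thesis
        unfolding C_def by (intro mult_left_mono mult_mono) auto
    qed
    have protocol: "\<exists>P :: (nat set, nat set, nat) protocol.
         finds P (admissible n t) (\<lambda>A B. mediocre (nat \<lfloor>real p / real q * real t\<rfloor>)
           (nat \<lfloor>real p / real q * real t\<rfloor>) (A \<union> B)) \<and>
         real (comm_complexity P (admissible n t)) \<le> 6 * (real l * log 2 (real h))"
      if "1 \<le> n" "c * real n \<le> real t" for n t :: nat
    proof (rule exists_protocol[OF h2 l_pos asm(3) _ that(2) two_l])
      have "0 < c * real n" using that(1) asm(3) by simp
      with that(2) show "0 < t" by linarith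
      have q: "0 < real q" using asm by linarith
      \<comment> \<open>This is the purpose of \<open>h\<close>: the fraction
        \<open>1 - 2 * \<alpha>\<close> of admissible ranks is at least \<open>2 / h\<close>, and
        the floor only widens the window.\<close>
      have "2 / real h \<le> (real q - 2 * real p) / real q"
        using h_ge gap q h2 by (simp add: field_simps)
      then have "2 / real h * real t \<le> (real q - 2 * real p) / real q * real t"
        by (rule mult_right_mono) simp
      also have "\<dots> = real t - 2 * (real p / real q * real t)"
        using q by (simp add: field_simps)
      also have "\<dots> \<le> real t - 2 * real (nat \<lfloor>real p / real q * real t\<rfloor>)"
        by (intro diff_left_mono mult_left_mono of_nat_floor) auto
      finally show "2 * real t / real h \<le> real t - 2 * real (nat \<lfloor>real p / real q * real t\<rfloor>)"
        by simp
    qed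
    show ?thesis
      unfolding Let_def h_eq of_int_of_nat_eq l_eq
      by (intro conjI allI impI bound) (elim conjE, rule protocol)
  qed
  show ?thesis
  proof (rule exI[of _ 6], rule conjI)
    show "(0::real) < 6" by simp
  qed (rule exI[of _ C], intro allI impI, elim conjE, rule main)
qed

end
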